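(* Let $A = (a_1,\ldots,a_{d-1},a_d)$ be a sequence of integers with $1 \le a_1,\ldots,a_{d-1} \le a_d$, let $a_0$ be an integer with $1 \le a_0 \le a_d$ such that $a_d \mid (a_0 + a_1 + \cdots + a_{d-1} + 1)$, and suppose that $1 \le a_0,\ldots,a_{d-1} < a_d$. Let $r$ be a positive integer such that $\Delta(A)$ is Gorenstein of index $r$; equivalently, $a_i \mid a_d$ for $0 \le i \le d-1$ and $r a_d = a_0 + \cdots + a_{d-1} + 1$. Set $\Delta = r\Delta(A) - (1,\ldots,1)$ and, for $0 \le i \le d-1$, $b_i = a_d/a_i$. Then $$\mathrm{Vol}(\Delta^\vee) = r\prod_{i=0}^{d-1} b_i.$$
   Context: $e_1,\ldots,e_d$ are the canonical unit coordinate vectors of $\mathbb{R}^d$. For a sequence of integers $A=(a_1,\ldots,a_d)$ with $1 \le a_1,\ldots,a_{d-1} \le a_d$, set $\Delta(A) = \mathrm{conv}(v_0,\ldots,v_d) \subset \mathbb{R}^d$, where $v_0 = (0,\ldots,0)$, $v_i = e_i$ for $1 \le i \le d-1$, and $v_d = \sum_{j=1}^{d-1}(a_d - a_j)e_j + a_d e_d$; it is a $d$-dimensional lattice simplex. A lattice polytope is a convex polytope all of whose vertices have integer coordinates. $\mathrm{Vol}(\mathcal{P})$ denotes the normalized volume, i.e. $d!$ times the Euclidean volume of a $d$-dimensional lattice polytope $\mathcal{P}\subset\mathbb{R}^d$. The dual polytope of $\mathcal{Q}\subset\mathbb{R}^d$ is $\mathcal{Q}^\vee = \{y \in \mathbb{R}^d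 : \langle x,y\rangle \le 1 \text{ for all } x \in \mathcal{Q}\}$. A $d$-dimensional lattice polytope $\mathcal{Q}$ is reflexive if the origin is the unique lattice point in its interior and $\mathcal{Q}^\vee$ is also a lattice polytope. A $d$-dimensional lattice polytope $\mathcal{P} \subset \mathbb{R}^d$ is Gorenstein of index $r$ ($r \in \mathbb{Z}_{>0}$) if there exist a reflexive polytope $\mathcal{Q} \subset \mathbb{R}^d$ and $w \in \mathbb{Z}^d$ with $\mathcal{Q} = r\mathcal{P} + w$. *)

theory Defs
  imports "HOL-Analysis.Analysis"
begin

definition integer_points :: "(real ^ 'n) set" where
  "integer_points = {x. \<forall>i. x $ i \<in> \<int>}"

definition lattice_polytope :: "(real ^ 'n) set \<Rightarrow> bool" where
  "lattice_polytope P \<longleftrightarrow> polytope P \<and> (\<forall>v. v extreme_point_of P \<longrightarrow> v \<in> integer_points)"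

definition full_dim_lattice_polytope :: "(real ^ 'n) set \<Rightarrow> bool" where
  "full_dim_lattice_polytope P \<longleftrightarrow> lattice_polytope P \<and> aff_dim P = int CARD('n)"

definition normalized_volume :: "(real ^ 'n) set \<Rightarrow> real" where
  "normalized_volume P = fact CARD('n) * measure lebesgue P"

definition dual_polytope :: "(real ^ 'n) set \<Rightarrow> (real ^ 'n) set" where
  "dual_polytope Q = {y. \<forall>x\<in>Q. x \<bullet> y \<le> 1}"

definition reflexive_polytope :: "(real ^ 'n) set \<Rightarrow> bool" where
  "reflexive_polytope Q \<longleftrightarrow>
     full_dim_lattice_polytope Q \<and>
     interior Q \<inter> integer_points = {0} \<and>
     lattice_polytope (dual_polytope Q)"

definition gorenstein_of_index :: "nat \<Rightarrow> (real ^ 'n) set \<Rightarrow> bool" where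
  "gorenstein_of_index r P \<longleftrightarrow>
     r > 0 \<and> full_dim_lattice_polytope P \<and>
     (\<exists>Q w. reflexive_polytope Q \<and> w \<in> integer_points \<and> Q = (\<lambda>x. real r *\<^sub>R x + w) ` P)"

text \<open>
  A finite index type carries no order, so the numbering \<open>1, \<dots>, d\<close> of the coordinates
  of \<^typ>\<open>real ^ 'n\<close>, where \<open>d = CARD('n)\<close>, is supplied by a bijection \<open>idx\<close> from
  \<open>{1..d}\<close> onto the index type. Sequences are functions on \<^typ>\<open>nat\<close>, of which only
  the relevant entries are used.
\<close>

definition coord_vec :: "(nat \<Rightarrow> 'n) \<Rightarrow> nat \<Rightarrow> real ^ 'n" where
  "coord_vec idx i = axis (idx i) 1"

definition simplex_vertex :: "(nat \<Rightarrow> 'n) \<Rightarrow> (nat \<Rightarrow> int) \<Rightarrow> nat \<Rightarrow> real ^ 'n" where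
  "simplex_vertex idx a i =
     (let d = CARD('n) in
      if i = 0 then 0
      else if i < d then coord_vec idx i
      else (\<Sum>j\<in>{1..<d}. real_of_int (a d - a j) *\<^sub>R coord_vec idx j)
             + real_of_int (a d) *\<^sub>R coord_vec idx d)"

definition hnf_simplex :: "(nat \<Rightarrow> 'n) \<Rightarrow> (nat \<Rightarrow> int) \<Rightarrow> (real ^ 'n) set" where
  "hnf_simplex idx a = convex hull (simplex_vertex idx a ` {0..CARD('n)})"

end

theory Submission
  imports Defs
begin

text \<open>
  The proof describes a simplex by its barycentric coordinates, the affine functions
  \<open>c i + n i \<bullet> x\<close> that form the dual basis of its vertices \<open>v i\<close>. If all \<open>c i\<close> are positive, the
  origin is an interior point and the dual polytope is the simplex with vertices
  \<open>u i = - n i / c i\<close>, in which the origin has the same barycentric coordinates \<open>c i\<close>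
  (\<open>polar_simplex\<close>, \<open>dual_polytope_simplex\<close>). Two consequences carry the theorem.

  A simplex is reflexive exactly when all \<open>c i\<close> are positive and all \<open>v i\<close> and \<open>u i\<close> are integral
  (\<open>reflexive_iff\<close>). For the translate of \<open>r\<close> times the given simplex by \<open>w\<close> this is an
  arithmetic condition on \<open>w\<close>. It forces \<open>r * c i = a i / a d\<close> for \<open>i < d\<close> and
  \<open>r * c d = 1 / a d\<close>, together with the divisibilities \<open>a i dvd a d\<close> (\<open>height_eqs\<close>); as the
  \<open>c i\<close> sum to 1, the formula for \<open>r\<close> follows. Conversely, under these conditions translation by
  the vector with all entries \<open>- 1\<close> gives a reflexive simplex (\<open>gorenstein_hnf_iff\<close>).

  The normalized volume of a simplex, that of its dual, and the product of the \<open>c i\<close> multiply to 1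
  (\<open>normalized_volume_times_dual\<close>), because the products of corresponding edge vectors of the two
  simplices form a diagonal matrix plus a constant one. The given simplex has normalized volume
  \<open>a d\<close>, being spanned by all unit vectors but the last and one vector with last entry \<open>a d\<close>. With
  the values of \<open>c i\<close> above, the volume of the dual is \<open>r\<close> times the product of the quotients
  \<open>a d / a i\<close>.
\<close>

section \<open>Determinants\<close>

text \<open>
  A permutation that fixes every index other than \<open>k\<close> also fixes \<open>k\<close>, so only the identity
  contributes to the Leibniz expansion.
\<close>

lemma det_diagonal_except_row:
  fixes A :: "'a::comm_ring_1^'n^'n"
  assumes "\<And>i j. i \<noteq> j \<Longrightarrow> i \<noteq> k \<Longrightarrow> A $ i $ j = 0"
  shows "det A = (\<Prod>i\<in>UNIV. A $ i $ i)"
proof -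
  let ?term = "\<lambda>p. of_int (sign p) * (\<Prod>i\<in>UNIV. A $ i $ p i)"
  have vanish: "?term p = 0" if p: "p permutes (UNIV :: 'n set)" and "p \<noteq> id" for p
  proof -
    have "\<exists>i. i \<noteq> k \<and> p i \<noteq> i"
    proof (rule ccontr)
      assume "\<nexists>i. i \<noteq> k \<and> p i \<noteq> i"
      then have fix_p: "p i = i" if "i \<noteq> k" for i
        using that by auto
      then have "p k = k"
        using permutes_inj[OF p] by (metis injD)
      with fix_p \<open>p \<noteq> id\<close> show False
        by (metis eq_id_iff)
    qed
    then obtain i where "A $ i $ p i = 0"
      using assms by metis
    then show ?thesis
      using prod_zero[of UNIV "\<lambda>i. A $ i $ p i"] by (metis UNIV_I finite mult_zero_right)
  qed
  have "det A = (\<Sum>p\<in>{id}. ?term p)"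
    unfolding det_def
    by (rule sum.mono_neutral_right) (use vanish in \<open>auto simp: permutes_id finite_permutations\<close>)
  then show ?thesis
    by simp
qed

corollary det_diagonal_except_column:
  fixes A :: "'a::comm_ring_1^'n^'n"
  assumes "\<And>i j. i \<noteq> j \<Longrightarrow> j \<noteq> k \<Longrightarrow> A $ i $ j = 0"
  shows "det A = (\<Prod>i\<in>UNIV. A $ i $ i)"
proof -
  have "det (transpose A) = (\<Prod>i\<in>UNIV. transpose A $ i $ i)"
    by (rule det_diagonal_except_row[of k]) (use assms in \<open>auto simp: transpose_def\<close>)
  then show ?thesis
    by (simp only: det_transpose) (simp add: transpose_def)
qed

text \<open>
  The rank-one case of the matrix determinant lemma. Let \<open>F\<close> be the identity with its row \<open>k\<close>
  replaced by ones. Conjugation by \<open>F\<close> turns the all-ones covector into the \<open>k\<close>-th coordinate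
  covector, so the rank-one perturbation of the identity becomes one that lives in column \<open>k\<close>
  alone, and the diagonal can be read off.
\<close>

lemma det_identity_plus_equal_columns:
  fixes x :: "'n::finite \<Rightarrow> real"
  shows "det (\<chi> i j. (if i = j then 1 else 0) + x i :: real^'n^'n) = 1 + sum x UNIV"
proof -
  obtain k :: 'n where True by blast
  define M :: "real^'n^'n" where "M = (\<chi> i j. (if i = j then 1 else 0) + x i)"
  define F :: "real^'n^'n" where "F = (\<chi> i j. if i = k \<or> i = j then 1 else 0)"
  define y where "y i = (if i = k then sum x UNIV else x i)" for i
  define G :: "real^'n^'n" where "G = (\<chi> i j. (if i = j then 1 else 0) + (if j = k then y i else 0))"
  have Fx: "(\<Sum>l\<in>UNIV. F $ i $ l * x l) = y i" for i
  proof (cases "i = k")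
    case False
    have "(\<Sum>l\<in>UNIV. F $ i $ l * x l) = (\<Sum>l\<in>UNIV. if l = i then x l else 0)"
      using False by (intro sum.cong) (auto simp: F_def)
    with False show ?thesis by (simp add: y_def)
  qed (simp add: F_def y_def)
  \<comment> \<open>\<open>y\<close> is \<open>F\<close> applied to \<open>x\<close>, so \<open>G\<close> is \<open>F ** M\<close> times the inverse of \<open>F\<close>.\<close>
  have FM: "(F ** M) $ i $ j = F $ i $ j + y i" for i j
  proof -
    have "(F ** M) $ i $ j = (\<Sum>l\<in>UNIV. (if l = j then F $ i $ l else 0) + F $ i $ l * x l)"
      unfolding matrix_matrix_mult_def M_def by (auto intro!: sum.cong simp: distrib_left)
    then show ?thesis
      by (simp add: sum.distrib Fx)
  qed
  have GF: "(G ** F) $ i $ j = F $ i $ j + y i" for i j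
  proof -
    have "(G ** F) $ i $ j =
        (\<Sum>l\<in>UNIV. (if l = i then F $ l $ j else 0) + (if l = k then y i * F $ l $ j else 0))"
      unfolding matrix_matrix_mult_def G_def by (auto intro!: sum.cong simp: distrib_right)
    then show ?thesis
      by (simp add: sum.distrib) (simp add: F_def)
  qed
  have "F ** M = G ** F"
    by (simp add: vec_eq_iff FM GF)
  moreover have "det F = 1"
    by (subst det_diagonal_except_row[of k]) (auto simp: F_def)
  ultimately have "det M = det G"
    by (metis det_mul mult_1 mult.right_neutral)
  also have "\<dots> = (\<Prod>i\<in>UNIV. G $ i $ i)"
    by (rule det_diagonal_except_column[of k]) (auto simp: G_def)
  also have "\<dots> = (\<Prod>i\<in>UNIV. if i = k then 1 + sum x UNIV else 1)"
    by (intro prod.cong) (auto simp: G_def y_def)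
  also have "\<dots> = 1 + sum x UNIV"
    by simp
  finally show ?thesis
    by (simp add: M_def)
qed

text \<open>
  Allowing two different index types makes it possible to carry determinant formulas from ordered
  index types to arbitrary finite ones.
\<close>

lemma det_reindex:
  fixes A :: "'a::comm_ring_1^'n^'n" and g :: "'m::finite \<Rightarrow> 'n::finite"
  assumes g: "bij g"
  shows "det (\<chi> i j. A $ g i $ g j) = det A"
proof -
  let ?back = "map_permutation UNIV (inv g)" and ?forth = "map_permutation UNIV g"
  have inj: "inj g" "inj (inv g)" and inv: "\<And>x. inv g (g x) = x" "\<And>x. g (inv g x) = x"
    using g bij_imp_bij_inv[OF g] by (auto simp: bij_is_inj bij_is_surj surj_f_inv_f)
  have bij: "bij_betw g UNIV UNIV" "bij_betw (inv g) UNIV UNIV"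
    using g bij_imp_bij_inv by auto
  show ?thesis
    unfolding det_def
  proof (rule sum.reindex_bij_witness[of _ ?back ?forth])
    fix p :: "'m \<Rightarrow> 'm" assume "p \<in> {p. p permutes UNIV}"
    then have p: "p permutes UNIV" by simp
    have apply_g: "?forth p (g i) = g (p i)" for i
      by (rule map_permutation_apply) (use inj in auto)
    show "?back (?forth p) = p"
      by (rule map_permutation_compose_inv[of _ _ UNIV]) (use bij p inv in auto)
    show "?forth p \<in> {p. p permutes UNIV}"
      using map_permutation_permutes[OF _ p] bij by auto
    have "(\<Prod>i\<in>UNIV. A $ i $ ?forth p i) = (\<Prod>i\<in>UNIV. A $ g i $ g (p i))"
      using prod.reindex_bij_betw[OF bij(1), of "\<lambda>i. A $ i $ ?forth p i"] by (simp add: apply_g)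
    then show "of_int (sign (?forth p)) * (\<Prod>i\<in>UNIV. A $ i $ ?forth p i) =
        of_int (sign p) * (\<Prod>i\<in>UNIV. (\<chi> i j. A $ g i $ g j) $ i $ p i)"
      using sign_map_permutation[of g UNIV p] inj p by simp
  next
    fix q :: "'n \<Rightarrow> 'n" assume "q \<in> {p. p permutes UNIV}"
    then have q: "q permutes UNIV" by simp
    show "?forth (?back q) = q"
      by (rule map_permutation_compose_inv[of _ _ UNIV]) (use bij q inv in auto)
    show "?back q \<in> {p. p permutes UNIV}"
      using map_permutation_permutes[OF _ q] bij by auto
  qed
qed

section \<open>Volume of a simplex\<close>

text \<open>
  The fact \<open>content_simplex\<close>, the determinant formula for the volume of a simplex, concerns
  coordinates indexed by a well-ordered type. Every finite type is in bijection with the following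
  well-ordered copy of it, and renaming coordinates changes neither volumes nor determinants.
\<close>

typedef (overloaded) ('a::finite) ordered_index = "{..<CARD('a)}"
  by (rule exI[of _ 0]) simp

lemma CARD_ordered_index: "CARD('a::finite ordered_index) = CARD('a)"
  using type_definition.card[OF type_definition_ordered_index] by simp

instance ordered_index :: (finite) finite
proof
  show "finite (UNIV :: 'a ordered_index set)"
    using type_definition.univ[OF type_definition_ordered_index]
    by (metis finite_imageI finite_lessThan)
qed

instantiation ordered_index :: (finite) wellorder
begin

definition "i \<le> j \<longleftrightarrow> Rep_ordered_index i \<le> Rep_ordered_index j"
definition "i < j \<longleftrightarrow> Rep_ordered_index i < Rep_ordered_index j"

instance
proof
  fix P :: "'a ordered_index \<Rightarrow> bool" and i :: "'a ordered_index"
  assume step: "\<And>i. (\<And>j. j < i \<Longrightarrow> P j) \<Longrightarrow> P i"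
  show "P i"
    by (induction "Rep_ordered_index i" arbitrary: i rule: less_induct)
      (use step in \<open>auto simp: less_ordered_index_def\<close>)
qed (auto simp: less_eq_ordered_index_def less_ordered_index_def Rep_ordered_index_inject)

end

text \<open>
  Renaming coordinates maps boxes to boxes with the same side lengths, and Lebesgue measure is
  determined by its values on boxes.
\<close>

lemma measure_permute_coordinates:
  fixes S :: "(real^'n) set" and g :: "'m::finite \<Rightarrow> 'n::finite"
  assumes g: "bij g" and S: "compact S"
  shows "measure lebesgue ((\<lambda>x. \<chi> j. x $ g j :: real^'m) ` S) = measure lebesgue S"
proof -
  let ?\<psi> = "\<lambda>y :: real^'m. \<chi> i. y $ inv g i :: real^'n"
  have inv: "inv g (g j) = j" "g (inv g i) = i" for i j
    using g by (auto simp: bij_is_inj bij_is_surj surj_f_inv_f)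
  have \<psi>: "?\<psi> \<in> borel_measurable borel"
    by (intro borel_measurable_continuous_onI continuous_intros)
  have vimage: "(\<lambda>x. \<chi> j. x $ g j) ` T = ?\<psi> -` T" for T :: "(real^'n) set"
    by (force simp: image_iff inv vec_eq_iff)
  have "lborel = distr lborel borel ?\<psi>"
  proof (rule lborel_eqI)
    fix l u :: "real^'n" assume le: "\<And>b. b \<in> Basis \<Longrightarrow> l \<bullet> b \<le> u \<bullet> b"
    have le': "l $ i \<le> u $ i" for i
      using le[of "axis i 1"] by (simp add: inner_axis)
    let ?l = "\<chi> j. l $ g j :: real^'m" and ?u = "\<chi> j. u $ g j :: real^'m"
    have "?\<psi> -` box l u = box ?l ?u"
      by (auto simp: mem_box_cart inv) (metis inv)+
    then have "emeasure (distr lborel borel ?\<psi>) (box l u) = emeasure lborel (box ?l ?u)"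
      using \<psi> by (simp add: emeasure_distr)
    also have "\<dots> = (\<Prod>b\<in>Basis. (?u - ?l) \<bullet> b)"
      by (rule emeasure_lborel_box) (auto simp: Basis_vec_def inner_axis le')
    also have "(\<Prod>b\<in>Basis. (?u - ?l) \<bullet> b) = (\<Prod>j\<in>UNIV. u $ g j - l $ g j)"
      by (simp add: Basis_vec_def prod.UNION_disjoint axis_eq_axis inner_axis)
    also have "\<dots> = (\<Prod>i\<in>UNIV. u $ i - l $ i)"
      using prod.reindex_bij_betw[of g UNIV UNIV "\<lambda>i. u $ i - l $ i"] g by simp
    also have "\<dots> = (\<Prod>b\<in>Basis. (u - l) \<bullet> b)"
      by (simp add: Basis_vec_def prod.UNION_disjoint axis_eq_axis inner_axis)
    finally show "emeasure (distr lborel borel ?\<psi>) (box l u) = (\<Prod>b\<in>Basis. (u - l) \<bullet> b)" .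
  qed simp
  then have "measure lborel S = measure (distr lborel borel ?\<psi>) S"
    by metis
  also have "\<dots> = measure lborel (?\<psi> -` S)"
    using S \<psi> by (simp add: measure_distr compact_imp_closed)
  finally have *: "measure lborel S = measure lborel (?\<psi> -` S)" .
  have "compact ((\<lambda>x. \<chi> j. x $ g j :: real^'m) ` S)"
    by (intro compact_continuous_image S continuous_intros)
  with S * show ?thesis
    by (simp add: vimage measure_completion compact_imp_closed)
qed

lemma normalized_volume_simplex:
  fixes p :: "'n::finite \<Rightarrow> real^'n"
  assumes inj: "inj p" and b: "b \<notin> range p"
  shows "normalized_volume (convex hull (insert b (range p))) = \<bar>det (\<chi> i. p i - b)\<bar>"
proof -
  have "\<exists>g :: 'n ordered_index \<Rightarrow> 'n. bij g"
    using finite_same_card_bij[of "UNIV :: 'n ordered_index set" "UNIV :: 'n set"]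
    by (simp add: CARD_ordered_index)
  then obtain g :: "'n ordered_index \<Rightarrow> 'n" where g: "bij g" by blast
  let ?\<phi> = "\<lambda>x :: real^'n. \<chi> j. x $ g j :: real^('n ordered_index)"
  let ?X = "insert b (range p)"
  have lin: "linear ?\<phi>"
    by (rule linearI) (simp_all add: vec_eq_iff)
  have inj_\<phi>: "inj ?\<phi>"
    by (rule injI) (metis vec_lambda_beta vec_eq_iff g bij_is_surj surjE)
  have "card ?X = Suc CARD('n)"
    using b by (simp add: card_image[OF inj])
  then have "card (?\<phi> ` ?X) = Suc CARD('n ordered_index)"
    using card_image[OF inj_on_subset[OF inj_\<phi> subset_UNIV], of ?X]
    by (simp only: CARD_ordered_index)
  moreover have "bij_betw (\<lambda>j. ?\<phi> (p (g j))) UNIV (?\<phi> ` ?X - {?\<phi> b})"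
    unfolding bij_betw_def
  proof
    show "inj (\<lambda>j. ?\<phi> (p (g j)))"
      using inj_compose[OF inj_compose[OF inj_\<phi> inj] bij_is_inj[OF g]] by (simp add: o_def)
    have "range (\<lambda>j. ?\<phi> (p (g j))) = ?\<phi> ` range p"
      using image_image[of "\<lambda>i. ?\<phi> (p i)" g UNIV] bij_is_surj[OF g]
      by (simp add: image_image del: vec_lambda_eta)
    also have "range p = ?X - {b}"
      using b by simp
    also have "?\<phi> ` (?X - {b}) = ?\<phi> ` ?X - {?\<phi> b}"
      using image_set_diff[OF inj_\<phi>, of ?X "{b}"] by (simp only: image_empty image_insert)
    finally show "range (\<lambda>j. ?\<phi> (p (g j))) = ?\<phi> ` ?X - {?\<phi> b}" .
  qed
  ultimately have "measure lborel (convex hull (?\<phi> ` ?X)) =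
      \<bar>det (\<chi> i j. ?\<phi> (p (g j)) $ i - ?\<phi> b $ i)\<bar> / fact CARD('n ordered_index)"
    by (intro content_simplex) auto
  also have "(\<chi> i j. ?\<phi> (p (g j)) $ i - ?\<phi> b $ i) =
      (\<chi> i j. transpose (\<chi> i. p i - b) $ g i $ g j)"
    by (simp add: transpose_def vec_eq_iff)
  finally have "measure lborel (convex hull (?\<phi> ` ?X)) = \<bar>det (\<chi> i. p i - b)\<bar> / fact CARD('n)"
    by (simp add: det_reindex[OF g] CARD_ordered_index)
  moreover have "measure lborel (convex hull (?\<phi> ` ?X)) = measure lebesgue (convex hull (?\<phi> ` ?X))"
    by (rule measure_completion[symmetric])
      (auto intro!: compact_imp_closed finite_imp_compact_convex_hull borel_closed)
  moreover have "\<dots> = measure lebesgue (convex hull ?X)"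
    using measure_permute_coordinates[OF g, of "convex hull ?X"]
    by (simp add: finite_imp_compact_convex_hull convex_hull_linear_image[OF lin])
  ultimately show ?thesis
    by (simp add: normalized_volume_def field_simps)
qed

section \<open>Simplices with barycentric coordinates\<close>

lemma inner_integer_points:
  "x \<in> integer_points \<Longrightarrow> y \<in> integer_points \<Longrightarrow> x \<bullet> y \<in> \<int>"
  unfolding inner_vec_def by (rule Ints_sum) (auto simp: integer_points_def)

lemma integer_points_component: "x \<in> integer_points \<Longrightarrow> x $ k \<in> \<int>"
  by (simp add: integer_points_def)

lemma integer_points_diff:
  "x \<in> integer_points \<Longrightarrow> y \<in> integer_points \<Longrightarrow> x - y \<in> integer_points"
  by (auto simp: integer_points_def)

text \<open>
  A full-dimensional simplex together with its barycentric coordinates, the affine functions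
  \<open>x \<mapsto> c i + n i \<bullet> x\<close>. The vector \<open>n i\<close> is an inner normal of the facet opposite the vertex
  \<open>v i\<close>, and \<open>c\<close> lists the barycentric coordinates of the origin. Recording the coordinates
  along with the vertices makes affine images and duals instances of the same structure, obtained
  by explicit formulas.
\<close>

locale barycentric_simplex =
  fixes I :: "'i set" and v n :: "'i \<Rightarrow> real^'n" and c :: "'i \<Rightarrow> real"
  assumes finite_I: "finite I"
    and coord_vertex: "\<And>i j. i \<in> I \<Longrightarrow> j \<in> I \<Longrightarrow> c i + n i \<bullet> v j = (if i = j then 1 else 0)"
    and coord_sum: "\<And>x. (\<Sum>i\<in>I. c i + n i \<bullet> x) = 1"
    and coord_expansion: "\<And>x. (\<Sum>i\<in>I. (c i + n i \<bullet> x) *\<^sub>R v i) = x"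
begin

lemma sum_constants: "sum c I = 1"
  using coord_sum[of 0] by simp

lemma barycenter_origin: "(\<Sum>i\<in>I. c i *\<^sub>R v i) = 0"
  using coord_expansion[of 0] by simp

lemma linear_expansion: "(\<Sum>i\<in>I. (n i \<bullet> x) *\<^sub>R v i) = x"
  using coord_expansion[of x] barycenter_origin
  by (simp add: scaleR_add_left sum.distrib)

lemma sum_normals: "sum n I = 0"
proof -
  have "sum n I \<bullet> x = 0" for x
    using coord_sum[of x] sum_constants by (simp add: sum.distrib inner_sum_left)
  then show ?thesis
    by (metis inner_eq_zero_iff)
qed

text \<open>
  The transpose of \<open>linear_expansion\<close>: the operator \<open>\<Sum>i. v i (n i)\<^sup>T\<close> is the identity, hence so is
  \<open>\<Sum>i. n i (v i)\<^sup>T\<close>.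
\<close>

lemma dual_expansion: "(\<Sum>i\<in>I. (v i \<bullet> y) *\<^sub>R n i) = y"
proof -
  have "x \<bullet> (\<Sum>i\<in>I. (v i \<bullet> y) *\<^sub>R n i) = (\<Sum>i\<in>I. (n i \<bullet> x) *\<^sub>R v i) \<bullet> y" for x
    by (simp add: inner_sum_left inner_sum_right inner_commute mult.commute)
  then show ?thesis
    by (simp only: linear_expansion) (use vector_eq_ldot in blast)
qed

lemma inj_on_vertices: "inj_on v I"
  by (rule inj_onI) (metis coord_vertex zero_neq_one)

text \<open>
  Evaluating every coordinate at its own vertex and summing gives the number of vertices. The
  constants contribute 1, and the linear parts contribute the trace of the identity operator.
\<close>

lemma card_vertices: "card I = Suc CARD('n)"
proof -
  have "real (card I) = (\<Sum>i\<in>I. c i + n i \<bullet> v i)"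
    by (simp add: coord_vertex)
  also have "\<dots> = 1 + (\<Sum>i\<in>I. n i \<bullet> v i)"
    by (simp add: sum.distrib sum_constants)
  also have "(\<Sum>i\<in>I. n i \<bullet> v i) = (\<Sum>k\<in>UNIV. \<Sum>i\<in>I. n i $ k * v i $ k)"
    by (subst sum.swap) (simp add: inner_vec_def)
  also have "\<dots> = (\<Sum>k\<in>(UNIV :: 'n set). 1)"
  proof (rule sum.cong)
    fix k :: 'n
    have "(\<Sum>i\<in>I. (n i \<bullet> axis k 1) *\<^sub>R v i) $ k = 1"
      by (simp only: linear_expansion) simp
    then show "(\<Sum>i\<in>I. n i $ k * v i $ k) = 1"
      by (simp add: inner_axis)
  qed simp
  finally show ?thesis by simp
qed

lemma ex_other_vertex: "\<exists>j\<in>I. j \<noteq> i"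
proof (rule ccontr)
  assume "\<not> (\<exists>j\<in>I. j \<noteq> i)"
  then have "card I \<le> card {i}"
    by (intro card_mono) auto
  then show False
    by (simp add: card_vertices)
qed

lemma normal_nonzero: "i \<in> I \<Longrightarrow> n i \<noteq> 0"
  using ex_other_vertex[of i] coord_vertex[of i i] coord_vertex[of i] by fastforce

lemma eq_if_coords_eq:
  assumes "\<And>i. i \<in> I \<Longrightarrow> n i \<bullet> x = n i \<bullet> y"
  shows "x = y"
proof -
  have "(\<Sum>i\<in>I. (n i \<bullet> x) *\<^sub>R v i) = (\<Sum>i\<in>I. (n i \<bullet> y) *\<^sub>R v i)"
    by (rule sum.cong) (auto simp: assms)
  then show ?thesis
    by (simp only: linear_expansion)
qed

lemma simplex_eq: "convex hull (v ` I) = {x. \<forall>i\<in>I. 0 \<le> c i + n i \<bullet> x}"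
proof
  have halfspaces: "{x. \<forall>i\<in>I. 0 \<le> c i + n i \<bullet> x} = (\<Inter>i\<in>I. {x. n i \<bullet> x \<ge> - c i})"
    by auto (smt (verit))+
  have "convex {x. \<forall>i\<in>I. 0 \<le> c i + n i \<bullet> x}"
    unfolding halfspaces by (intro convex_INT convex_halfspace_ge)
  then show "convex hull (v ` I) \<subseteq> {x. \<forall>i\<in>I. 0 \<le> c i + n i \<bullet> x}"
    by (intro hull_minimal) (auto simp: coord_vertex)
  show "{x. \<forall>i\<in>I. 0 \<le> c i + n i \<bullet> x} \<subseteq> convex hull (v ` I)"
  proof
    fix x assume "x \<in> {x. \<forall>i\<in>I. 0 \<le> c i + n i \<bullet> x}"
    then have "(\<Sum>i\<in>I. (c i + n i \<bullet> x) *\<^sub>R v i) \<in> convex hull (v ` I)"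
      by (intro convex_sum finite_I coord_sum) (auto intro: hull_inc)
    then show "x \<in> convex hull (v ` I)"
      by (simp only: coord_expansion)
  qed
qed

text \<open>
  Since no normal vanishes, a point where some coordinate is zero lies on the boundary of a
  half-space that contains the simplex.
\<close>

lemma interior_simplex: "interior (convex hull (v ` I)) = {x. \<forall>i\<in>I. 0 < c i + n i \<bullet> x}"
proof
  show "interior (convex hull (v ` I)) \<subseteq> {x. \<forall>i\<in>I. 0 < c i + n i \<bullet> x}"
  proof clarify
    fix x i assume x: "x \<in> interior (convex hull (v ` I))" and i: "i \<in> I"
    have "convex hull (v ` I) \<subseteq> {x. (- n i) \<bullet> x \<le> c i}"
      using i by (auto simp: simplex_eq)
    then have "x \<in> interior {x. (- n i) \<bullet> x \<le> c i}"
      using x interior_mono by blast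
    then show "0 < c i + n i \<bullet> x"
      using normal_nonzero[OF i] by (subst (asm) interior_halfspace_le) auto
  qed
  have "{x. \<forall>i\<in>I. 0 < c i + n i \<bullet> x} = (\<Inter>i\<in>I. {x. n i \<bullet> x > - c i})"
    by auto (smt (verit))+
  moreover have "open \<dots>"
    by (intro open_INT finite_I ballI open_halfspace_gt)
  ultimately show "{x. \<forall>i\<in>I. 0 < c i + n i \<bullet> x} \<subseteq> interior (convex hull (v ` I))"
    by (intro interior_maximal) (auto simp: simplex_eq intro: less_imp_le)
qed

text \<open>
  All coordinates of \<open>v j\<close> but one are zero, the least possible value on the simplex. Both ends of a
  segment around \<open>v j\<close> then have these coordinates zero as well, which determines them.
\<close>

lemma extreme_vertex:
  assumes j: "j \<in> I"
  shows "v j extreme_point_of (convex hull (v ` I))"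
  unfolding extreme_point_of_def
proof (intro conjI ballI notI)
  show "v j \<in> convex hull (v ` I)"
    using j by (auto intro: hull_inc)
  fix a b assume ab: "a \<in> convex hull (v ` I)" "b \<in> convex hull (v ` I)" "v j \<in> open_segment a b"
  then obtain t where t: "0 < t" "t < 1" and vj: "v j = (1 - t) *\<^sub>R a + t *\<^sub>R b" and "a \<noteq> b"
    by (auto simp: in_segment)
  have coord: "c i + n i \<bullet> v j = (1 - t) * (c i + n i \<bullet> a) + t * (c i + n i \<bullet> b)" for i
    by (simp add: vj inner_add_right algebra_simps)
  have zero: "c i + n i \<bullet> a = 0 \<and> c i + n i \<bullet> b = 0" if "i \<in> I" "i \<noteq> j" for i
  proof -
    have "0 \<le> c i + n i \<bullet> a" "0 \<le> c i + n i \<bullet> b"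
      using ab that by (auto simp: simplex_eq)
    moreover have "(1 - t) * (c i + n i \<bullet> a) + t * (c i + n i \<bullet> b) = 0"
      using coord[of i] coord_vertex[OF \<open>i \<in> I\<close> j] that by simp
    ultimately show ?thesis
      using t by (simp add: add_nonneg_eq_0_iff)
  qed
  have "a = b"
  proof (rule eq_if_coords_eq)
    fix i assume i: "i \<in> I"
    have "c j + n j \<bullet> a = c j + n j \<bullet> b"
      using coord_sum[of a] coord_sum[of b] zero
      by (simp add: sum.remove[OF finite_I j])
    with zero[OF i] show "n i \<bullet> a = n i \<bullet> b"
      by (cases "i = j") auto
  qed
  with \<open>a \<noteq> b\<close> show False by simp
qed

lemma lattice_polytope_iff:
  "lattice_polytope (convex hull (v ` I)) \<longleftrightarrow> (\<forall>i\<in>I. v i \<in> integer_points)"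
proof -
  have "polytope (convex hull (v ` I))"
    unfolding polytope_def using finite_I by blast
  then show ?thesis
    unfolding lattice_polytope_def
    using extreme_vertex extreme_point_of_convex_hull by blast
qed

text \<open>
  The barycenter has positive coordinates, so the interior is not empty.
\<close>

lemma aff_dim_simplex: "aff_dim (convex hull (v ` I)) = int CARD('n)"
proof -
  let ?x = "(1 / card I) *\<^sub>R sum v I"
  have I: "0 < card I"
    by (simp add: card_vertices)
  have "c i + n i \<bullet> ?x = 1 / card I" if "i \<in> I" for i
  proof -
    have "(\<Sum>j\<in>I. c i + n i \<bullet> v j) = (\<Sum>j\<in>I. if i = j then 1 else 0)"
      using that by (intro sum.cong) (auto simp: coord_vertex)
    then have "card I * c i + n i \<bullet> sum v I = 1"
      using that finite_I by (simp add: sum.distrib inner_sum_right)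
    then show ?thesis
      using I by (simp add: field_simps)
  qed
  then have "?x \<in> interior (convex hull (v ` I))"
    using I by (simp add: interior_simplex)
  then show ?thesis
    by (metis aff_dim_nonempty_interior empty_iff DIM_cart DIM_real mult.right_neutral)
qed

text \<open>
  The barycentric coordinates of \<open>y = r x + w\<close> in the image are those of \<open>x\<close> in the original
  simplex.
\<close>

lemma affine_image:
  assumes r: "r \<noteq> 0"
  shows "barycentric_simplex I (\<lambda>i. r *\<^sub>R v i + w) (\<lambda>i. (1 / r) *\<^sub>R n i) (\<lambda>i. c i - n i \<bullet> w / r)"
proof -
  have coord: "c i - n i \<bullet> w / r + (1 / r) *\<^sub>R n i \<bullet> x = c i + n i \<bullet> ((1 / r) *\<^sub>R (x - w))" for i x
    by (simp add: inner_diff_right diff_divide_distrib)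
  show ?thesis
  proof (unfold_locales, unfold coord)
    fix i j assume "i \<in> I" "j \<in> I"
    then show "c i + n i \<bullet> ((1 / r) *\<^sub>R (r *\<^sub>R v j + w - w)) = (if i = j then 1 else 0)"
      using coord_vertex r by simp
  next
    fix x
    show "(\<Sum>i\<in>I. (c i + n i \<bullet> ((1 / r) *\<^sub>R (x - w))) *\<^sub>R (r *\<^sub>R v i + w)) = x"
      using r coord_sum[of "(1 / r) *\<^sub>R (x - w)"]
        arg_cong[OF coord_expansion[of "(1 / r) *\<^sub>R (x - w)"], of "(*\<^sub>R) r"]
      by (simp only: scaleR_add_right sum.distrib scaleR_sum_right scaleR_left_commute[of _ r]
          scaleR_sum_left[symmetric]) simp
  qed (rule finite_I coord_sum)+
qed

text \<open>
  If the origin is an interior point, the facet opposite \<open>v i\<close> is \<open>u i \<bullet> x = 1\<close> for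
  \<open>u i = - n i / c i\<close>, and the coordinates become \<open>c i * (1 - u i \<bullet> x)\<close>. This form is symmetric in
  \<open>u\<close> and \<open>v\<close>: the points \<open>u i\<close> are the vertices of a simplex with coordinates
  \<open>c i * (1 - v i \<bullet> y)\<close>, and the origin has the same weights \<open>c i\<close> in both.
\<close>

lemma polar_simplex:
  assumes c: "\<And>i. i \<in> I \<Longrightarrow> 0 < c i"
  shows "barycentric_simplex I (\<lambda>i. - (1 / c i) *\<^sub>R n i) (\<lambda>i. - c i *\<^sub>R v i) c"
proof
  show "finite I"
    by (rule finite_I)
next
  fix i j assume ij: "i \<in> I" "j \<in> I"
  then have "c i + (- c i *\<^sub>R v i) \<bullet> (- (1 / c j) *\<^sub>R n j) = c i / c j * (c j + n j \<bullet> v i)"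
    using c[of j] by (simp add: inner_commute field_simps)
  then show "c i + (- c i *\<^sub>R v i) \<bullet> (- (1 / c j) *\<^sub>R n j) = (if i = j then 1 else 0)"
    using coord_vertex[of j i] c[of i] c[of j] ij by auto
next
  fix y :: "real^'n"
  have "(\<Sum>i\<in>I. c i * (v i \<bullet> y)) = 0"
    using barycenter_origin by (metis (mono_tags, lifting) inner_scaleR_left inner_sum_left inner_zero_left sum.cong)
  then show "(\<Sum>i\<in>I. c i + (- c i *\<^sub>R v i) \<bullet> y) = 1"
    by (simp add: sum_subtractf sum_constants)
  have "(\<Sum>i\<in>I. (c i + (- c i *\<^sub>R v i) \<bullet> y) *\<^sub>R (- (1 / c i) *\<^sub>R n i)) =
      (\<Sum>i\<in>I. (v i \<bullet> y) *\<^sub>R n i - n i)"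
  proof (rule sum.cong)
    fix i assume "i \<in> I"
    then have "(c i + (- c i *\<^sub>R v i) \<bullet> y) * - (1 / c i) = v i \<bullet> y - 1"
      using c[of i] by (simp add: field_simps)
    then show "(c i + (- c i *\<^sub>R v i) \<bullet> y) *\<^sub>R (- (1 / c i) *\<^sub>R n i) = (v i \<bullet> y) *\<^sub>R n i - n i"
      by (simp only: scaleR_scaleR) (simp add: scaleR_diff_left)
  qed simp
  also have "\<dots> = y"
    by (simp add: sum_subtractf dual_expansion sum_normals)
  finally show "(\<Sum>i\<in>I. (c i + (- c i *\<^sub>R v i) \<bullet> y) *\<^sub>R (- (1 / c i) *\<^sub>R n i)) = y" .
qed

text \<open>
  Being in the dual means \<open>v i \<bullet> y \<le> 1\<close> for every vertex, and these inequalities say that the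
  coordinates of the polar simplex are nonnegative.
\<close>

lemma dual_polytope_simplex:
  assumes c: "\<And>i. i \<in> I \<Longrightarrow> 0 < c i"
  shows "dual_polytope (convex hull (v ` I)) = convex hull ((\<lambda>i. - (1 / c i) *\<^sub>R n i) ` I)"
proof -
  interpret polar: barycentric_simplex I "\<lambda>i. - (1 / c i) *\<^sub>R n i" "\<lambda>i. - c i *\<^sub>R v i" c
    by (rule polar_simplex) (rule c)
  have hull: "(\<forall>x\<in>convex hull (v ` I). x \<bullet> y \<le> 1) \<longleftrightarrow> (\<forall>i\<in>I. v i \<bullet> y \<le> 1)" for y
  proof -
    have "convex hull (v ` I) \<subseteq> {x. y \<bullet> x \<le> 1} \<longleftrightarrow> v ` I \<subseteq> {x. y \<bullet> x \<le> 1}"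
      by (metis convex_halfspace_le hull_minimal hull_subset order_trans)
    then show ?thesis
      by (auto simp: subset_iff inner_commute)
  qed
  have "0 \<le> c i + (- c i *\<^sub>R v i) \<bullet> y \<longleftrightarrow> v i \<bullet> y \<le> 1" if "i \<in> I" for i y
    using c[OF that] by (simp add: mult_le_cancel_left1)
  then show ?thesis
    by (simp only: dual_polytope_def hull polar.simplex_eq) blast
qed

text \<open>
  Integrality of both vertex sets already makes the origin the only interior lattice point: at an
  interior lattice point \<open>x\<close> each \<open>u i \<bullet> x\<close> is an integer less than 1, so every \<open>n i \<bullet> x\<close> is
  nonnegative. As the normals sum to zero, all these products vanish and \<open>x = 0\<close>.
\<close>

lemma reflexive_iff:
  "reflexive_polytope (convex hull (v ` I)) \<longleftrightarrow>
    (\<forall>i\<in>I. v i \<in> integer_points \<and> 0 < c i \<and> - (1 / c i) *\<^sub>R n i \<in> integer_points)"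
proof -
  have origin: "0 \<in> interior (convex hull (v ` I)) \<longleftrightarrow> (\<forall>i\<in>I. 0 < c i)"
    by (simp add: interior_simplex)
  have dual: "lattice_polytope (dual_polytope (convex hull (v ` I))) \<longleftrightarrow>
      (\<forall>i\<in>I. - (1 / c i) *\<^sub>R n i \<in> integer_points)" if c: "\<forall>i\<in>I. 0 < c i"
    using barycentric_simplex.lattice_polytope_iff[OF polar_simplex] dual_polytope_simplex c
    by simp
  have unique: "x = 0"
    if "x \<in> interior (convex hull (v ` I))" and x: "x \<in> integer_points" and c: "\<forall>i\<in>I. 0 < c i"
      and u: "\<forall>i\<in>I. - (1 / c i) *\<^sub>R n i \<in> integer_points" for x
  proof -
    have nonneg: "0 \<le> n i \<bullet> x" if i: "i \<in> I" for i
    proof -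
      have "0 < c i" "0 < c i + n i \<bullet> x"
        using c i \<open>x \<in> interior _\<close> by (auto simp: interior_simplex)
      then have "(- (1 / c i) *\<^sub>R n i) \<bullet> x < 1"
        by (simp add: field_simps)
      moreover have "(- (1 / c i) *\<^sub>R n i) \<bullet> x \<in> \<int>"
        using u i x by (intro inner_integer_points) auto
      ultimately have "(- (1 / c i) *\<^sub>R n i) \<bullet> x \<le> 0"
        by (auto elim!: Ints_cases)
      then show ?thesis
        using \<open>0 < c i\<close> by (simp add: zero_le_divide_iff)
    qed
    have "(\<Sum>i\<in>I. n i \<bullet> x) = 0"
      using coord_sum[of x] by (simp add: sum.distrib sum_constants)
    then have "n i \<bullet> x = 0" if "i \<in> I" for i
      using nonneg that finite_I by (simp add: sum_nonneg_eq_0_iff)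
    then show "x = 0"
      by (intro eq_if_coords_eq) simp
  qed
  have "0 \<in> integer_points"
    by (simp add: integer_points_def)
  then show ?thesis
    unfolding reflexive_polytope_def full_dim_lattice_polytope_def
    using origin dual unique aff_dim_simplex lattice_polytope_iff by blast
qed

text \<open>
  Here \<open>r * c i - n i \<bullet> w\<close> is \<open>r\<close> times the \<open>i\<close>-th coordinate of the origin with respect to the
  image under \<open>x \<mapsto> r x + w\<close>.
\<close>

lemma gorenstein_iff:
  assumes v: "\<And>i. i \<in> I \<Longrightarrow> v i \<in> integer_points" and r: "0 < r"
  shows "gorenstein_of_index r (convex hull (v ` I)) \<longleftrightarrow>
    (\<exists>w\<in>integer_points. \<forall>i\<in>I. 0 < r * c i - n i \<bullet> w \<and>
       - (1 / (r * c i - n i \<bullet> w)) *\<^sub>R n i \<in> integer_points)"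
proof -
  have "reflexive_polytope ((\<lambda>x. real r *\<^sub>R x + w) ` (convex hull (v ` I))) \<longleftrightarrow>
      (\<forall>i\<in>I. 0 < r * c i - n i \<bullet> w \<and> - (1 / (r * c i - n i \<bullet> w)) *\<^sub>R n i \<in> integer_points)"
    if w: "w \<in> integer_points" for w
  proof -
    interpret image: barycentric_simplex I "\<lambda>i. real r *\<^sub>R v i + w" "\<lambda>i. (1 / real r) *\<^sub>R n i"
      "\<lambda>i. c i - n i \<bullet> w / real r"
      by (rule affine_image) (use r in simp)
    have "(\<lambda>x. real r *\<^sub>R x + w) ` (convex hull (v ` I)) = convex hull ((\<lambda>i. real r *\<^sub>R v i + w) ` I)"
      using convex_hull_affinity[of w "real r" "v ` I"] by (simp add: add.commute image_image)
    moreover have "real r *\<^sub>R v i + w \<in> integer_points" if "i \<in> I" for i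
      using v[OF that] w by (auto simp: integer_points_def)
    moreover have "0 < c i - n i \<bullet> w / real r \<longleftrightarrow> 0 < r * c i - n i \<bullet> w" for i
      using r by (simp add: field_simps)
    moreover have "1 / (c i - n i \<bullet> w / real r) * (1 / real r) = 1 / (r * c i - n i \<bullet> w)" for i
      using r by (simp add: field_simps)
    ultimately show ?thesis
      by (simp add: image.reflexive_iff)
  qed
  moreover have "full_dim_lattice_polytope (convex hull (v ` I))"
    using v by (simp add: full_dim_lattice_polytope_def lattice_polytope_iff aff_dim_simplex)
  ultimately show ?thesis
    using r by (auto simp: gorenstein_of_index_def)
qed

text \<open>
  The edge from \<open>v i\<close> to any other vertex is integral, and its inner product with \<open>- t * n i\<close>
  is \<open>t\<close>.
\<close>

lemma normal_scale_integer:
  assumes v: "\<And>i. i \<in> I \<Longrightarrow> v i \<in> integer_points" and i: "i \<in> I"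
    and t: "- t *\<^sub>R n i \<in> integer_points"
  shows "t \<in> \<int>"
proof -
  obtain j where j: "j \<in> I" "j \<noteq> i"
    using ex_other_vertex by blast
  have "n i \<bullet> (v j - v i) = - 1"
    using coord_vertex[OF i i] coord_vertex[OF i j(1)] j(2) by (simp add: inner_diff_right)
  then have "(- t *\<^sub>R n i) \<bullet> (v j - v i) = t"
    by simp
  then show ?thesis
    by (metis inner_integer_points integer_points_diff t v i j(1))
qed

lemma normalized_volume_eq_det:
  assumes "b \<in> I" and f: "bij_betw f (UNIV :: 'n set) (I - {b})"
  shows "normalized_volume (convex hull (v ` I)) = \<bar>det (\<chi> i. v (f i) - v b)\<bar>"
proof -
  have range_f: "range f = I - {b}" and "inj f"
    using f by (auto simp: bij_betw_def)
  then have "inj (\<lambda>i. v (f i))"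
    using comp_inj_on[of f UNIV v] inj_on_subset[OF inj_on_vertices, of "range f"]
    by (auto simp: o_def)
  moreover have range: "range (\<lambda>i. v (f i)) = v ` (I - {b})"
    using range_f by (metis image_image)
  moreover have "v b \<notin> v ` (I - {b})"
    using inj_on_vertices \<open>b \<in> I\<close> by (auto simp: inj_on_def)
  moreover have "insert (v b) (v ` (I - {b})) = v ` I"
    using \<open>b \<in> I\<close> by auto
  ultimately show ?thesis
    using normalized_volume_simplex[of "\<lambda>i. v (f i)" "v b"] by simp
qed

text \<open>
  The product of the two volumes depends only on the barycentric coordinates of the origin. Let
  \<open>V\<close> and \<open>U\<close> have as rows the edges of the simplex and of its dual that issue from
  \<open>v b\<close> and \<open>u b\<close>. As \<open>u i \<bullet> v j\<close> is 1 for \<open>i \<noteq> j\<close> and \<open>1 - 1 / c i\<close> for \<open>i = j\<close>, the product of \<open>U\<close> with the transpose of \<open>V\<close> is a diagonal matrix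
  plus a constant one, whose determinant is known.
\<close>

theorem normalized_volume_times_dual:
  assumes c: "\<And>i. i \<in> I \<Longrightarrow> 0 < c i"
  shows "normalized_volume (convex hull (v ` I)) *
      normalized_volume (dual_polytope (convex hull (v ` I))) * prod c I = 1"
proof -
  define u where "u i = - (1 / c i) *\<^sub>R n i" for i
  interpret polar: barycentric_simplex I u "\<lambda>i. - c i *\<^sub>R v i" c
    unfolding u_def by (rule polar_simplex) (rule c)
  obtain b where b: "b \<in> I"
    using ex_other_vertex by blast
  have "card (UNIV :: 'n set) = card (I - {b})"
    using b by (simp add: card_vertices)
  then obtain f where f: "bij_betw f (UNIV :: 'n set) (I - {b})"
    using finite_same_card_bij[of "UNIV :: 'n set" "I - {b}"] finite_I by auto
  then have f_I: "f i \<in> I" "f i \<noteq> b" and f_eq: "f i = f j \<longleftrightarrow> i = j" for i j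
    by (auto simp: bij_betw_def dest: injD)
  define V :: "real^'n^'n" where "V = (\<chi> i. v (f i) - v b)"
  define U :: "real^'n^'n" where "U = (\<chi> i. u (f i) - u b)"
  have pairing: "u i \<bullet> v j = 1 - (if i = j then 1 / c i else 0)" if "i \<in> I" "j \<in> I" for i j
    using coord_vertex[OF that] c[OF that(1)] by (auto simp: u_def field_simps)
  have "(U ** transpose V) $ i $ j = (u (f i) - u b) \<bullet> (v (f j) - v b)" for i j
    by (simp add: matrix_matrix_mult_def transpose_def U_def V_def inner_vec_def)
  then have entry: "(U ** transpose V) $ i $ j = - (if i = j then 1 / c (f i) else 0) - 1 / c b" for i j
    using f_I f_I(2)[THEN not_sym] b by (simp add: inner_diff_left inner_diff_right pairing f_eq)
  have "U ** transpose V =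
      (\<chi> i. (- 1 / c (f i)) *s (\<chi> j. (if i = j then 1 else 0) + c (f i) / c b))"
    using c f_I(1) by (auto simp: vec_eq_iff entry less_imp_neq[THEN not_sym] algebra_simps)
  then have "det (U ** transpose V) =
      (\<Prod>i\<in>UNIV. - 1 / c (f i)) * det (\<chi> i j. (if i = j then 1 else 0) + c (f i) / c b :: real^'n^'n)"
    by (simp only: det_rows_mul)
  then have "det U * det V = (\<Prod>i\<in>UNIV. - 1 / c (f i)) * (1 + (\<Sum>i\<in>UNIV. c (f i) / c b))"
    by (simp only: det_identity_plus_equal_columns det_mul det_transpose)
  also have "1 + (\<Sum>i\<in>UNIV. c (f i) / c b) = 1 / c b"
  proof -
    have "(\<Sum>i\<in>UNIV. c (f i)) = sum c (I - {b})"
      by (rule sum.reindex_bij_betw[OF f])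
    also have "\<dots> = 1 - c b"
      using sum.remove[OF finite_I b, of c] by (simp add: sum_constants)
    finally show ?thesis
      using c[OF b] by (simp add: sum_divide_distrib[symmetric] field_simps)
  qed
  also have "(\<Prod>i\<in>UNIV. - 1 / c (f i)) = (\<Prod>i\<in>I - {b}. - 1 / c i)"
    by (rule prod.reindex_bij_betw[OF f])
  finally have "\<bar>det U\<bar> * \<bar>det V\<bar> = (\<Prod>i\<in>I - {b}. \<bar>- 1 / c i\<bar>) * \<bar>1 / c b\<bar>"
    by (metis abs_mult abs_prod)
  also have "(\<Prod>i\<in>I - {b}. \<bar>- 1 / c i\<bar>) = (\<Prod>i\<in>I - {b}. 1 / c i)"
    using c by (intro prod.cong) (auto simp: abs_if dest: less_asym)
  also have "\<bar>1 / c b\<bar> = 1 / c b"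
    using c[OF b] by simp
  also have "(\<Prod>i\<in>I - {b}. 1 / c i) * (1 / c b) = 1 / prod c I"
    using prod.remove[OF finite_I b, of c] by (simp add: prod_dividef mult.commute)
  finally have "\<bar>det U\<bar> * \<bar>det V\<bar> * prod c I = 1"
    using c prod_pos[of I c] by simp
  moreover have "normalized_volume (convex hull (v ` I)) = \<bar>det V\<bar>"
    unfolding V_def by (rule normalized_volume_eq_det[OF b f])
  moreover have "normalized_volume (dual_polytope (convex hull (v ` I))) = \<bar>det U\<bar>"
    using polar.normalized_volume_eq_det[OF b f] c
    by (simp only: dual_polytope_simplex U_def) (simp add: u_def[abs_def])
  ultimately show ?thesis
    by (simp add: mult.commute)
qed

end

section \<open>The simplex in Hermite normal form\<close>

text \<open>
  If the positive number \<open>\<alpha>\<close> is an integer multiple of \<open>z + \<alpha>\<close> then \<open>z + \<alpha> \<le> \<alpha>\<close>, so the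
  integer \<open>z\<close> satisfies \<open>- 1 < z \<le> 0\<close>.
\<close>

lemma integer_shift_eq_0_if_quotient_integer:
  fixes z \<alpha> :: real
  assumes "z \<in> \<int>" "0 < \<alpha>" "\<alpha> < 1" "0 < z + \<alpha>" "\<alpha> / (z + \<alpha>) \<in> \<int>"
  shows "z = 0"
proof -
  from \<open>z \<in> \<int>\<close> obtain k :: int where k: "z = of_int k"
    by (rule Ints_cases)
  from \<open>\<alpha> / (z + \<alpha>) \<in> \<int>\<close> obtain m :: int where m: "\<alpha> / (z + \<alpha>) = of_int m"
    by (rule Ints_cases)
  have "0 < real_of_int m"
    using assms by (metis m divide_pos_pos)
  then have "1 \<le> \<alpha> / (z + \<alpha>)"
    using m by simp
  then have "z \<le> 0"
    using assms by (simp add: field_simps)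
  moreover have "- 1 < real_of_int k"
    using assms k by linarith
  ultimately show ?thesis
    using k by simp
qed

text \<open>
  The linear parts of the barycentric coordinates of the simplex in Hermite normal form that belong
  to the nonzero vertices. They are linear forms because the remaining vertex is the origin, and are
  found by solving \<open>x = \<Sum>i. t i * v i\<close> for \<open>t\<close>.
\<close>

definition side_normal :: "(nat \<Rightarrow> 'n) \<Rightarrow> (nat \<Rightarrow> int) \<Rightarrow> nat \<Rightarrow> real ^ 'n" where
  "side_normal idx a i =
    (let d = CARD('n) in
     if i = d then (1 / real_of_int (a d)) *\<^sub>R coord_vec idx d
     else coord_vec idx i - (1 - real_of_int (a i) / real_of_int (a d)) *\<^sub>R coord_vec idx d)"

text \<open>
  The coordinate of the vertex 0 is 1 minus the sum of the others.
\<close>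

definition facet_normal :: "(nat \<Rightarrow> 'n) \<Rightarrow> (nat \<Rightarrow> int) \<Rightarrow> nat \<Rightarrow> real ^ 'n" where
  "facet_normal idx a i =
    (if i = 0 then - (\<Sum>j\<in>{1..CARD('n)}. side_normal idx a j) else side_normal idx a i)"

locale hnf_sequence =
  fixes idx :: "nat \<Rightarrow> 'n::finite" and a :: "nat \<Rightarrow> int" and d :: nat
  assumes d: "d = CARD('n)"
    and idx: "bij_betw idx {1..d} UNIV"
    and a_bounds: "\<And>i. i \<in> {0..<d} \<Longrightarrow> 1 \<le> a i \<and> a i < a d"
    and a_dvd: "a d dvd (\<Sum>i\<in>{0..<d}. a i) + 1"
begin

abbreviation "v \<equiv> simplex_vertex idx a"
abbreviation "n \<equiv> facet_normal idx a"
abbreviation "ratio i \<equiv> real_of_int (a i) / real_of_int (a d)"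

lemma d_pos: "1 \<le> d"
  by (simp add: d Suc_le_eq)

lemma a_last_pos: "0 < a d"
  using a_bounds[of 0] d_pos by simp

lemma ratio_bounds: "i < d \<Longrightarrow> 0 < ratio i \<and> ratio i < 1"
  using a_bounds[of i] a_last_pos by (simp add: divide_simps)

lemma idx_eq_iff: "i \<in> {1..d} \<Longrightarrow> j \<in> {1..d} \<Longrightarrow> idx i = idx j \<longleftrightarrow> i = j"
  using inj_on_eq_iff[OF bij_betw_imp_inj_on[OF idx]] .

lemma coord_vec_inner: "coord_vec idx i \<bullet> x = x $ idx i"
  by (simp add: coord_vec_def inner_commute inner_axis)

lemma vertices_split: "{0..d} = insert 0 (insert d {1..<d})"
  using d_pos by auto

lemma positive_split: "{1..d} = insert d {1..<d}"
  using d_pos by auto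

lemma side_normal_inner:
  "side_normal idx a i \<bullet> x =
    (if i = d then x $ idx d / a d else x $ idx i - x $ idx d + ratio i * x $ idx d)"
  by (simp add: side_normal_def Let_def d[symmetric] inner_diff_left coord_vec_inner algebra_simps)

lemma vertex_component:
  assumes j: "j \<in> {0..d}" and m: "m \<in> {1..d}"
  shows "v j $ idx m =
    (if j = 0 then 0 else if j < d then if j = m then 1 else 0
     else if m = d then a d else a d - a m)"
proof -
  have axis: "coord_vec idx l $ idx m = (if l = m then 1 else 0)" if "l \<in> {1..d}" for l
    using idx_eq_iff[OF m that] by (simp add: coord_vec_def axis_def eq_commute[of l m])
  have "(\<Sum>l\<in>{1..<d}. real_of_int (a d - a l) * coord_vec idx l $ idx m) =
      (\<Sum>l\<in>{1..<d}. if l = m then real_of_int (a d - a l) else 0)"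
    by (intro sum.cong) (simp_all add: axis)
  then have last: "v d $ idx m = (if m = d then a d else a d - a m)"
    using m d_pos axis[of d] by (simp add: simplex_vertex_def Let_def d[symmetric])
  consider "j = 0" | "1 \<le> j" "j < d" | "j = d"
    using j by fastforce
  then show ?thesis
  proof cases
    case 2
    then show ?thesis
      using axis[of j] by (simp add: simplex_vertex_def Let_def d[symmetric])
  qed (use last d_pos in \<open>simp_all add: simplex_vertex_def\<close>)
qed

lemma vertex_integer: "j \<in> {0..d} \<Longrightarrow> v j \<in> integer_points"
proof -
  assume j: "j \<in> {0..d}"
  have "v j $ k \<in> \<int>" for k
  proof -
    obtain m where "m \<in> {1..d}" "k = idx m"
      using bij_betw_imp_surj_on[OF idx] by (metis UNIV_I imageE)
    then show ?thesis
      using vertex_component[OF j] by auto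
  qed
  then show ?thesis
    by (simp add: integer_points_def)
qed

lemma side_normal_vertex:
  assumes "i \<in> {1..d}" "j \<in> {0..d}"
  shows "side_normal idx a i \<bullet> v j = (if i = j then 1 else 0)"
proof -
  have d: "d \<in> {1..d}"
    using d_pos by simp
  show ?thesis
    using vertex_component[OF assms(2) d] vertex_component[OF assms(2,1)] assms a_last_pos d_pos
    by (cases "i = d"; cases "j = d"; cases "j = 0") (auto simp: side_normal_inner field_simps)
qed

lemma facet_normal_simps:
  "i \<noteq> 0 \<Longrightarrow> n i = side_normal idx a i"
  "n 0 = - (\<Sum>j\<in>{1..d}. side_normal idx a j)"
  by (simp_all add: facet_normal_def d)

lemma standard_expansion: "(\<Sum>j\<in>{1..<d}. x $ idx j *\<^sub>R coord_vec idx j) + x $ idx d *\<^sub>R coord_vec idx d = x"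
proof -
  have "(\<Sum>j\<in>{1..d}. x $ idx j *\<^sub>R coord_vec idx j) = (\<Sum>k\<in>UNIV. x $ k *\<^sub>R axis k 1)"
    unfolding coord_vec_def by (rule sum.reindex_bij_betw[OF idx])
  also have "\<dots> = x"
    using basis_expansion[of x] by (simp add: scalar_mult_eq_scaleR)
  finally show ?thesis
    unfolding positive_split by (simp add: add.commute)
qed

sublocale barycentric_simplex "{0..d}" v n "\<lambda>i. if i = 0 then 1 else 0"
proof
  fix i j assume i: "i \<in> {0..d}" and j: "j \<in> {0..d}"
  show "(if i = 0 then 1 else 0) + n i \<bullet> v j = (if i = j then 1 else 0)"
  proof (cases "i = 0")
    case True
    have "(\<Sum>l\<in>{1..d}. side_normal idx a l \<bullet> v j) = (\<Sum>l\<in>{1..d}. if l = j then 1 else 0)"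
      using j by (intro sum.cong) (auto simp: side_normal_vertex)
    then show ?thesis
      using True j by (auto simp: facet_normal_simps inner_sum_left)
  next
    case False
    then show ?thesis
      using i j by (simp add: facet_normal_simps side_normal_vertex)
  qed
next
  fix x :: "real^'n"
  have "(\<Sum>i\<in>{1..d}. (if i = 0 then 1 else 0) + n i \<bullet> x) = (\<Sum>i\<in>{1..d}. side_normal idx a i \<bullet> x)"
    by (intro sum.cong) (auto simp: facet_normal_simps)
  moreover have "{0..d} = insert 0 {1..d}"
    by auto
  ultimately show "(\<Sum>i\<in>{0..d}. (if i = 0 then 1 else 0) + n i \<bullet> x) = 1"
    by (simp add: facet_normal_simps inner_sum_left)
  have "(\<Sum>i\<in>{0..d}. ((if i = 0 then 1 else 0) + n i \<bullet> x) *\<^sub>R v i) =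
      (\<Sum>i\<in>{1..<d}. (x $ idx i - x $ idx d + ratio i * x $ idx d) *\<^sub>R coord_vec idx i)
        + (x $ idx d / a d) *\<^sub>R v d"
  proof -
    have "(\<Sum>i\<in>{1..<d}. ((if i = 0 then 1 else 0) + n i \<bullet> x) *\<^sub>R v i) =
        (\<Sum>i\<in>{1..<d}. (x $ idx i - x $ idx d + ratio i * x $ idx d) *\<^sub>R coord_vec idx i)"
      by (intro sum.cong)
        (auto simp: facet_normal_simps side_normal_inner simplex_vertex_def Let_def d[symmetric])
    moreover have "v 0 = 0"
      by (simp add: simplex_vertex_def)
    ultimately show ?thesis
      using d_pos by (simp add: vertices_split facet_normal_simps side_normal_inner)
  qed
  also have "(x $ idx d / a d) *\<^sub>R v d =
      (\<Sum>i\<in>{1..<d}. (x $ idx d - ratio i * x $ idx d) *\<^sub>R coord_vec idx i) + x $ idx d *\<^sub>R coord_vec idx d"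
    using a_last_pos d_pos
    by (simp add: simplex_vertex_def Let_def d[symmetric] scaleR_add_right scaleR_sum_right
        diff_divide_distrib algebra_simps)
  finally show "(\<Sum>i\<in>{0..d}. ((if i = 0 then 1 else 0) + n i \<bullet> x) *\<^sub>R v i) = x"
    using standard_expansion[of x]
    by (simp add: add.assoc[symmetric] sum.distrib[symmetric] scaleR_add_left[symmetric])
qed simp

text \<open>
  Modulo the integers, the \<open>i\<close>-th facet normal acts on lattice points as \<open>a i / a d\<close> times the last
  coordinate. For \<open>i = 0\<close> this is where the divisibility of \<open>a 0 + \<dots> + a (d - 1) + 1\<close> by
  \<open>a d\<close> enters.
\<close>

lemma facet_normal_inner_integer_point:
  assumes i: "i < d" and x: "x \<in> integer_points"
  shows "n i \<bullet> x - ratio i * x $ idx d \<in> \<int>"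
proof (cases "i = 0")
  case False
  then show ?thesis
    using i x by (simp add: facet_normal_simps side_normal_inner integer_points_def)
next
  case True
  obtain k where k: "(\<Sum>i\<in>{0..<d}. a i) + 1 = a d * k"
    using a_dvd by blast
  have "{0..<d} = insert 0 {1..<d}"
    using d_pos by auto
  then have "(\<Sum>i\<in>{1..<d}. a i) + 1 = a d * k - a 0"
    using k by simp
  then have "(\<Sum>i\<in>{1..<d}. real_of_int (a i)) + 1 = a d * k - a 0"
    by (metis (mono_tags, lifting) of_int_1 of_int_add of_int_diff of_int_mult of_int_sum sum.cong)
  then have ratios: "(\<Sum>i\<in>{1..<d}. ratio i) + 1 / a d = k - ratio 0"
    using a_last_pos by (simp add: sum_divide_distrib[symmetric] field_simps)
  have "n 0 \<bullet> x = - (\<Sum>i\<in>{1..<d}. x $ idx i - x $ idx d + ratio i * x $ idx d) - x $ idx d / a d"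
    unfolding facet_normal_simps positive_split by (simp add: inner_diff_left inner_sum_left side_normal_inner)
  also have "\<dots> = - (\<Sum>i\<in>{1..<d}. x $ idx i - x $ idx d) - x $ idx d * ((\<Sum>i\<in>{1..<d}. ratio i) + 1 / a d)"
    by (simp add: sum.distrib sum_distrib_left distrib_left mult.commute)
  finally have "n 0 \<bullet> x - ratio 0 * x $ idx d = - (\<Sum>i\<in>{1..<d}. x $ idx i - x $ idx d) - x $ idx d * k"
    unfolding ratios by (simp add: algebra_simps)
  moreover have "\<dots> \<in> \<int>"
    using x by (intro Ints_diff Ints_minus Ints_sum Ints_mult) (auto simp: integer_points_def)
  ultimately show ?thesis
    using True by simp
qed

lemma hnf_simplex_eq: "hnf_simplex idx a = convex hull (v ` {0..d})"
  by (simp add: hnf_simplex_def d)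

text \<open>
  Up to the factor \<open>r\<close>, the barycentric coordinates of the origin in the simplex scaled by \<open>r\<close> and
  translated by \<open>w\<close>.
\<close>

abbreviation "height r w i \<equiv> real r * (if i = 0 then 1 else 0) - n i \<bullet> w"

lemma sum_heights: "(\<Sum>i\<in>{0..d}. height r w i) = real r"
  using sum_normals by (simp add: sum_subtractf inner_sum_left[symmetric] sum_distrib_left[symmetric])

text \<open>
  The last height is \<open>- w_d / a_d\<close> for the last entry \<open>w_d\<close> of \<open>w\<close>, and integrality of the
  corresponding dual vertex makes \<open>1 / w_d\<close> an integer, so \<open>w_d = - 1\<close>. Any other height is then
  \<open>a i / a d\<close> plus an integer, its reciprocal is an integer, and the last entry of the dual vertex
  forces \<open>a i / a d\<close> to be an integer multiple of it. As \<open>a i < a d\<close>, the height is \<open>a i / a d\<close>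
  itself, and its reciprocal \<open>a d / a i\<close> is an integer.
\<close>

lemma height_eqs:
  assumes w: "w \<in> integer_points"
    and pos: "\<And>i. i \<in> {0..d} \<Longrightarrow> 0 < height r w i"
    and int: "\<And>i. i \<in> {0..d} \<Longrightarrow> - (1 / height r w i) *\<^sub>R n i \<in> integer_points"
  shows "height r w d = 1 / a d" and "i < d \<Longrightarrow> height r w i = ratio i \<and> a i dvd a d"
proof -
  have n_d: "n d \<bullet> x = x $ idx d / a d" for x
    using d_pos by (simp add: facet_normal_simps side_normal_inner)
  have component: "n i $ k = n i \<bullet> axis k 1" for i k
    by (simp add: inner_axis)
  have w_d: "w $ idx d = - 1"
  proof -
    have "(- (1 / height r w d) *\<^sub>R n d) $ idx d \<in> \<int>"
      by (rule integer_points_component[OF int]) simp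
    moreover have "(- (1 / height r w d) *\<^sub>R n d) $ idx d = 1 / w $ idx d"
      using a_last_pos d_pos by (simp add: component n_d del: inner_axis)
    ultimately obtain p :: int where p: "1 / w $ idx d = p"
      by (metis Ints_cases)
    obtain q :: int where q: "w $ idx d = q"
      using w by (metis Ints_cases integer_points_def mem_Collect_eq)
    \<comment> \<open>The height \<open>- q / a d\<close> is positive.\<close>
    have "q < 0"
      using pos[of d] a_last_pos d_pos by (simp add: n_d q divide_less_0_iff)
    with p q have "real_of_int (p * q) = 1"
      by (simp add: field_simps)
    then have "p * q = 1"
      by linarith
    with \<open>q < 0\<close> show ?thesis
      by (auto simp: q zmult_eq_1_iff)
  qed
  then show "height r w d = 1 / a d"
    using d_pos by (simp add: n_d)
  assume i: "i < d"
  then have i': "i \<in> {0..d}" by simp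
  define N where "N = 1 / height r w i"
  have N: "N \<in> \<int>"
    using normal_scale_integer[OF vertex_integer i'] int[OF i'] by (simp add: N_def)
  have "N * ratio i \<in> \<int>"
  proof -
    have "(axis (idx d) 1 :: real^'n) \<in> integer_points"
      by (simp add: integer_points_def axis_def)
    then have "n i $ idx d - ratio i \<in> \<int>"
      using facet_normal_inner_integer_point[OF i, of "axis (idx d) 1"] by (simp add: component)
    then have "N * (n i $ idx d - ratio i) \<in> \<int>"
      by (rule Ints_mult[OF N])
    moreover have "(- N *\<^sub>R n i) $ idx d \<in> \<int>"
      unfolding N_def by (rule integer_points_component[OF int[OF i']])
    ultimately have "- (N * (n i $ idx d - ratio i) + (- N *\<^sub>R n i) $ idx d) \<in> \<int>"
      by (intro Ints_minus Ints_add)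
    then show ?thesis
      by (simp add: algebra_simps)
  qed
  then have "ratio i / (height r w i - ratio i + ratio i) \<in> \<int>"
    by (simp add: N_def mult.commute)
  moreover have "height r w i - ratio i \<in> \<int>"
  proof -
    have "real r * (if i = 0 then 1 else 0) - (n i \<bullet> w - ratio i * w $ idx d) \<in> \<int>"
      by (rule Ints_diff[OF _ facet_normal_inner_integer_point[OF i w]]) simp
    then show ?thesis
      by (simp add: w_d algebra_simps)
  qed
  ultimately have "height r w i = ratio i"
    using integer_shift_eq_0_if_quotient_integer[of "height r w i - ratio i" "ratio i"]
      ratio_bounds[OF i] pos[OF i'] by (simp only: diff_add_cancel) simp
  moreover from this N have "real_of_int (a d) / real_of_int (a i) \<in> \<int>"
    by (simp add: N_def)
  then have "a i dvd a d"
    using a_bounds[of i] i by (simp add: of_int_div_of_int_in_Ints_iff)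
  ultimately show "height r w i = ratio i \<and> a i dvd a d" by blast
qed

lemma sum_eq_if_heights:
  assumes "\<And>i. i < d \<Longrightarrow> height r w i = ratio i" and "height r w d = 1 / a d"
  shows "int r * a d = (\<Sum>i\<in>{0..<d}. a i) + 1"
proof -
  have "real r = (\<Sum>i\<in>{0..<d}. height r w i) + height r w d"
    using sum_heights[of r w] by (simp add: atLeastLessThanSuc_atLeastAtMost[symmetric])
  also have "(\<Sum>i\<in>{0..<d}. height r w i) = (\<Sum>i\<in>{0..<d}. ratio i)"
    by (rule sum.cong) (auto simp: assms)
  finally have "real r = (\<Sum>i\<in>{0..<d}. real_of_int (a i)) / a d + 1 / a d"
    by (simp add: assms sum_divide_distrib)
  then have "real r * a d = (\<Sum>i\<in>{0..<d}. real_of_int (a i)) + 1"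
    using a_last_pos by (simp add: field_simps)
  then have "real_of_int (int r * a d) = real_of_int ((\<Sum>i\<in>{0..<d}. a i) + 1)"
    by simp
  then show ?thesis
    by linarith
qed

text \<open>
  For \<open>0 < i < d\<close> and \<open>i = d\<close> the height is computed directly; the height with index 0 is what
  remains of the total \<open>r\<close>.
\<close>

lemma heights_of_minus_one:
  assumes r: "int r * a d = (\<Sum>i\<in>{0..<d}. a i) + 1"
  shows "height r (- (\<chi> i. 1)) d = 1 / a d" and "i < d \<Longrightarrow> height r (- (\<chi> i. 1)) i = ratio i"
proof -
  let ?h = "height r (- (\<chi> i. 1))"
  show last: "?h d = 1 / a d"
    using d_pos by (simp add: facet_normal_simps side_normal_inner)
  have side: "?h i = ratio i" if "i \<in> {1..<d}" for i
    using that by (simp add: facet_normal_simps side_normal_inner)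
  have "{0..<d} = insert 0 {1..<d}"
    using d_pos by auto
  moreover have "real_of_int (int r * a d) = real_of_int ((\<Sum>i\<in>{0..<d}. a i) + 1)"
    using r by simp
  ultimately have "real r = (\<Sum>i\<in>{1..<d}. ratio i) + ratio 0 + 1 / a d"
    using a_last_pos by (simp add: sum_divide_distrib[symmetric] field_simps)
  moreover have "real r = ?h 0 + (?h d + (\<Sum>i\<in>{1..<d}. ratio i))"
  proof -
    have "(\<Sum>i\<in>{1..<d}. ?h i) = (\<Sum>i\<in>{1..<d}. ratio i)"
      by (rule sum.cong[OF refl], rule side)
    moreover have "(\<Sum>i\<in>{0..d}. ?h i) = ?h 0 + (?h d + (\<Sum>i\<in>{1..<d}. ?h i))"
      unfolding vertices_split using d_pos by (subst sum.insert; simp)+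
    ultimately show ?thesis
      by (simp only: sum_heights)
  qed
  ultimately have "?h 0 = ratio 0"
    using last by linarith
  then show "i < d \<Longrightarrow> ?h i = ratio i"
    using side[of i] by (cases "i = 0") auto
qed

text \<open>
  The heights are forced to be the numbers \<open>a i / a d\<close> and \<open>1 / a d\<close>, and they sum to \<open>r\<close>. In the
  other direction the translation vector with all entries \<open>- 1\<close> realizes these heights.
\<close>

theorem gorenstein_hnf_iff:
  assumes "0 < r"
  shows "gorenstein_of_index r (hnf_simplex idx a) \<longleftrightarrow>
    (\<forall>i\<in>{0..<d}. a i dvd a d) \<and> int r * a d = (\<Sum>i\<in>{0..<d}. a i) + 1"
proof -
  have "(\<exists>w\<in>integer_points. \<forall>i\<in>{0..d}. 0 < height r w i \<and> - (1 / height r w i) *\<^sub>R n i \<in> integer_points) \<longleftrightarrow>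
    (\<forall>i\<in>{0..<d}. a i dvd a d) \<and> int r * a d = (\<Sum>i\<in>{0..<d}. a i) + 1" (is "?L \<longleftrightarrow> ?R")
  proof
    assume ?L
    then obtain w where w: "w \<in> integer_points" "\<And>i. i \<in> {0..d} \<Longrightarrow> 0 < height r w i"
      "\<And>i. i \<in> {0..d} \<Longrightarrow> - (1 / height r w i) *\<^sub>R n i \<in> integer_points"
      by blast
    note eqs = height_eqs[OF w]
    show ?R
      using eqs sum_eq_if_heights[of r w] by auto
  next
    assume R: ?R
    let ?w = "- (\<chi> i. 1) :: real^'n"
    note heights = heights_of_minus_one[OF conjunct2[OF R]]
    have "?w \<in> integer_points"
      by (simp add: integer_points_def)
    moreover have "0 < height r ?w i \<and> - (1 / height r ?w i) *\<^sub>R n i \<in> integer_points"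
      if "i \<in> {0..d}" for i
    proof (cases "i = d")
      case True
      have "- (1 / height r ?w d) *\<^sub>R n d = - coord_vec idx d"
        using a_last_pos d_pos
        by (simp only: heights) (simp add: facet_normal_simps side_normal_def Let_def d[symmetric])
      moreover have "- coord_vec idx d \<in> integer_points"
        by (simp add: integer_points_def coord_vec_def axis_def)
      moreover have "0 < height r ?w d"
        using a_last_pos by (simp only: heights) simp
      ultimately show ?thesis
        using True by simp
    next
      case False
      with that have i: "i < d" by simp
      have b: "1 / ratio i \<in> \<int>"
        using R i a_bounds[of i] by (simp add: of_int_div_of_int_in_Ints_iff)
      have "(- (1 / ratio i) *\<^sub>R n i) $ k \<in> \<int>" for k
      proof -
        have x: "(axis k 1 :: real^'n) \<in> integer_points"
          by (simp add: integer_points_def axis_def)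
        have "n i $ k = n i \<bullet> axis k 1"
          by (simp add: inner_axis)
        then have "(- (1 / ratio i) *\<^sub>R n i) $ k =
            - (1 / ratio i) * (n i \<bullet> axis k 1 - ratio i * axis k 1 $ idx d) - axis k 1 $ idx d"
          using a_bounds[of i] i by (simp add: field_simps)
        also have "\<dots> \<in> \<int>"
          by (rule Ints_diff[OF Ints_mult[OF Ints_minus[OF b] facet_normal_inner_integer_point[OF i x]]
                integer_points_component[OF x]])
        finally show ?thesis .
      qed
      then show ?thesis
        using ratio_bounds[OF i] by (simp only: heights(2)[OF i]) (simp add: integer_points_def)
    qed
    ultimately show ?L by blast
  qed
  then show ?thesis
    unfolding hnf_simplex_eq by (subst gorenstein_iff) (use assms vertex_integer in auto)
qed

text \<open>
  The origin has barycentric coordinates \<open>a i / (r * a d)\<close> for \<open>i < d\<close> and \<open>1 / (r * a d)\<close> for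
  \<open>i = d\<close>, and the dilated simplex has normalized volume \<open>r ^ d * a d\<close>. The volume of the dual is
  the reciprocal of the product of all these numbers.
\<close>

theorem normalized_volume_dual_hnf:
  assumes r: "0 < r" and sum: "int r * a d = (\<Sum>i\<in>{0..<d}. a i) + 1"
  shows "normalized_volume (dual_polytope ((\<lambda>x. real r *\<^sub>R x - (\<chi> i. 1)) ` hnf_simplex idx a)) =
    real r * (\<Prod>i\<in>{0..<d}. real_of_int (a d) / real_of_int (a i))"
proof -
  let ?w = "- (\<chi> i. 1) :: real^'n"
  note heights = heights_of_minus_one[OF sum]
  let ?c = "\<lambda>i. (if i = 0 then 1 else 0) - n i \<bullet> ?w / real r"
  interpret Q: barycentric_simplex "{0..d}" "\<lambda>i. real r *\<^sub>R v i + ?w" "\<lambda>i. (1 / real r) *\<^sub>R n i" ?c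
    by (rule affine_image) (use r in simp)
  let ?Q = "convex hull ((\<lambda>i. real r *\<^sub>R v i + ?w) ` {0..d})"
  have Q: "(\<lambda>x. real r *\<^sub>R x - (\<chi> i. 1)) ` hnf_simplex idx a = ?Q"
    using convex_hull_affinity[of ?w "real r" "v ` {0..d}"]
    by (simp add: hnf_simplex_eq image_image)
  have c: "?c i = height r ?w i / r" for i
    using r by (simp add: field_simps)
  have c_last: "?c d = 1 / (r * a d)" and c_side: "i < d \<Longrightarrow> ?c i = ratio i / r" for i
    by (simp_all only: c heights) simp
  have c_pos: "0 < ?c i" if "i \<in> {0..d}" for i
    using that c_last c_side[of i] a_bounds[of i] r a_last_pos
    by (cases "i = d") (simp_all only:, auto)
  have "prod ?c {0..d} = (\<Prod>i\<in>{0..<d}. ?c i) * ?c d"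
    by (simp only: atLeastLessThanSuc_atLeastAtMost[symmetric] prod.atLeast0_lessThan_Suc)
  also have "(\<Prod>i\<in>{0..<d}. ?c i) = (\<Prod>i\<in>{0..<d}. ratio i / r)"
    by (rule prod.cong) (simp_all only: c_side atLeastLessThan_iff)
  finally have prod_c: "prod ?c {0..d} = (\<Prod>i\<in>{0..<d}. ratio i) / real r ^ d * (1 / (r * a d))"
    by (simp only: c_last) (simp add: prod_dividef power_mult_distrib)
  have vol_Q: "normalized_volume ?Q = real r ^ d * a d"
  proof -
    \<comment> \<open>Measured from the image of 0, the edges are \<open>r * v i\<close>, and \<open>v i\<close> is a unit vector for
      \<open>0 < i < d\<close>; the only row with entries off the diagonal belongs to \<open>v d\<close>.\<close>
    define f where "f = inv_into {1..d} idx"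
    have f: "bij_betw f UNIV ({0..d} - {0})"
    proof -
      have "{0..d} - {0} = {1..d}" by auto
      then show ?thesis
        unfolding f_def using bij_betw_inv_into[OF idx] by (simp only:)
    qed
    have f_in: "f i \<in> {1..d}" and idx_f: "idx (f i) = i" for i
      using bij_betw_imp_surj_on[OF idx] unfolding f_def
      by (metis UNIV_I inv_into_into, metis UNIV_I f_inv_into_f)
    then have f_eq: "f i = f j \<longleftrightarrow> i = j" for i j
      by metis
    have entry: "(real r *\<^sub>R v (f i)) $ j =
        real r * (if f i < d then if i = j then 1 else 0 else if f j = d then a d else a d - a (f j))" for i j
      using vertex_component[of "f i" "f j"] f_in[of i] f_in[of j] idx_f by (auto simp: idx_f f_eq)
    have f_last: "f i = d \<longleftrightarrow> i = idx d" for i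
      using idx_f d_pos by (metis f_def bij_betw_imp_inj_on idx inv_into_f_f atLeastAtMost_iff order_refl)
    have f_less: "f i < d \<longleftrightarrow> i \<noteq> idx d" for i
      using f_in[of i] f_last[of i] by auto
    have "det (\<chi> i. (real r *\<^sub>R v (f i) + ?w) - (real r *\<^sub>R v 0 + ?w)) = det (\<chi> i. real r *\<^sub>R v (f i))"
      by (simp add: simplex_vertex_def)
    also have "\<dots> = (\<Prod>i\<in>UNIV. (\<chi> i. real r *\<^sub>R v (f i)) $ i $ i)"
      by (rule det_diagonal_except_row[of "idx d"]) (simp add: entry f_less del: vector_scaleR_component)
    also have "\<dots> = (\<Prod>i\<in>(UNIV :: 'n set). real r * (if i = idx d then real_of_int (a d) else 1))"
      by (intro prod.cong) (auto simp: entry f_less f_last simp del: vector_scaleR_component)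
    also have "\<dots> = real r ^ d * a d"
      by (simp add: prod.distrib d)
    finally show ?thesis
      using Q.normalized_volume_eq_det[OF _ f] a_last_pos by simp
  qed
  have "prod ratio {0..<d} \<noteq> 0"
    using a_bounds a_last_pos by fastforce
  moreover have "real r ^ d * a d * normalized_volume (dual_polytope ?Q)
      * ((\<Prod>i\<in>{0..<d}. ratio i) / real r ^ d * (1 / (r * a d))) = 1"
    using Q.normalized_volume_times_dual[OF c_pos] unfolding vol_Q prod_c .
  ultimately have "normalized_volume (dual_polytope ?Q) = real r / (\<Prod>i\<in>{0..<d}. ratio i)"
    using r a_last_pos by (simp add: field_simps)
  also have "\<dots> = real r * (\<Prod>i\<in>{0..<d}. real_of_int (a d) / real_of_int (a i))"
    by (simp add: prod_dividef)
  finally show ?thesis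
    unfolding Q .
qed

end

theorem theorem4p1:
  fixes idx :: "nat \<Rightarrow> 'n::finite"
    and a :: "nat \<Rightarrow> int"
    and d r :: nat
  assumes "d = CARD('n)"
    and "bij_betw idx {1..d} UNIV"
    and "\<And>i. i \<in> {1..<d} \<Longrightarrow> 1 \<le> a i \<and> a i \<le> a d"
    and "1 \<le> a 0" and "a 0 \<le> a d"
    and "a d dvd (\<Sum>i\<in>{0..<d}. a i) + 1"
    and "\<And>i. i \<in> {0..<d} \<Longrightarrow> 1 \<le> a i \<and> a i < a d"
    and "r > 0"
  shows "(gorenstein_of_index r (hnf_simplex idx a) \<longleftrightarrow>
            (\<forall>i\<in>{0..<d}. a i dvd a d) \<and> int r * a d = (\<Sum>i\<in>{0..<d}. a i) + 1) \<and>
         (gorenstein_of_index r (hnf_simplex idx a) \<longrightarrow>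
            normalized_volume
              (dual_polytope ((\<lambda>x. real r *\<^sub>R x - (\<chi> i. 1)) ` hnf_simplex idx a))
            = real r * (\<Prod>i\<in>{0..<d}. real_of_int (a d) / real_of_int (a i)))"
proof -
  interpret hnf_sequence idx a d
    using assms by unfold_locales auto
  show ?thesis
    using gorenstein_hnf_iff normalized_volume_dual_hnf \<open>r > 0\<close> by blast
qed

end
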